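(* Let $k$ and $i$ be integers with $2 \le i \le k-1$. The payoff query complexity of finding a $\left(1-\frac1i\right)$-approximate Nash equilibrium of a $k\times k$ bimatrix game (with payoffs in $[0,1]$) is at most $2k-i+1$.
   Context: A $k\times k$ bimatrix game is a pair $(R,C)$ of $k\times k$ matrices: $R$ gives the payoffs of the row player and $C$ those of the column player; all payoffs are assumed to lie in $[0,1]$. A mixed strategy is a probability distribution over $[k]=\{1,\dots,k\}$. Under a mixed strategy profile $(\mathbf x,\mathbf y)$ the row player's regret is $\max_{j\in[k]}(R_j\cdot\mathbf y)-\mathbf x\cdot R\cdot\mathbf y$ and the column player's regret is $\max_{j\in[k]}(\mathbf x\cdot C)_j-\mathbf x\cdot C\cdot\mathbf y$. The profile is an $\epsilon$-Nash equilibrium ($\epsilon$-approximate Nash equilibrium) if both regrets are at most $\epsilon$. A payoff query selects a pure-strategy profile (row $r$, column $c$) and receives as response the payoffs $R_{r,c}$ and $C_{r,c}$. The payoff query complexity of a class of games with respect to a solution concept is the smallest $N$ such that some (deterministic) algorithm, initially knowing none of the payoffs, finds a solution of every game in the class using at most $N$ payoff queries. Queries may be chosen adaptively, and no computational bound is imposed on the algorithm. *)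

theory Defs
  imports "Jordan_Normal_Form.Matrix" "HOL-Library.Extended_Nat"
begin

(* Pure strategies are indexed by {..<k}, the index convention of the matrix library,
   in place of {1..k}. *)

definition bimatrix_games :: "nat \<Rightarrow> (real mat \<times> real mat) set" where
  "bimatrix_games k = {(R, C). R \<in> carrier_mat k k \<and> C \<in> carrier_mat k k \<and>
     (\<forall>r<k. \<forall>c<k. R $$ (r, c) \<in> {0..1} \<and> C $$ (r, c) \<in> {0..1})}"

definition mixed_strategy :: "nat \<Rightarrow> real vec \<Rightarrow> bool" where
  "mixed_strategy k x \<longleftrightarrow> x \<in> carrier_vec k \<and> (\<forall>j<k. 0 \<le> x $ j) \<and> (\<Sum>j<k. x $ j) = 1"

definition row_regret :: "nat \<Rightarrow> real mat \<Rightarrow> real vec \<Rightarrow> real vec \<Rightarrow> real" where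
  "row_regret k R x y = (MAX j\<in>{..<k}. row R j \<bullet> y) - x \<bullet> (R *\<^sub>v y)"

definition column_regret :: "nat \<Rightarrow> real mat \<Rightarrow> real vec \<Rightarrow> real vec \<Rightarrow> real" where
  "column_regret k C x y = (MAX j\<in>{..<k}. x \<bullet> col C j) - x \<bullet> (C *\<^sub>v y)"

definition approx_nash ::
    "nat \<Rightarrow> real \<Rightarrow> real mat \<times> real mat \<Rightarrow> real vec \<times> real vec \<Rightarrow> bool" where
  "approx_nash k \<epsilon> = (\<lambda>(R, C) (x, y). mixed_strategy k x \<and> mixed_strategy k y \<and>
     row_regret k R x y \<le> \<epsilon> \<and> column_regret k C x y \<le> \<epsilon>)"

(* A deterministic adaptive algorithm is a decision tree: an inner node names the pure profile
   (row, column) to query and continues as a function of the two payoffs received; a leaf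
   returns a strategy profile.  The continuations are arbitrary functions, so there is no
   computational bound. *)
datatype query_algorithm =
    Return "real vec \<times> real vec"
  | Query nat nat "real \<Rightarrow> real \<Rightarrow> query_algorithm"

primrec returned_profile :: "real mat \<times> real mat \<Rightarrow> query_algorithm \<Rightarrow> real vec \<times> real vec" where
  "returned_profile G (Return p) = p"
| "returned_profile G (Query r c f) = returned_profile G (f (fst G $$ (r, c)) (snd G $$ (r, c)))"

primrec queries :: "real mat \<times> real mat \<Rightarrow> query_algorithm \<Rightarrow> (nat \<times> nat) list" where
  "queries G (Return p) = []"
| "queries G (Query r c f) = (r, c) # queries G (f (fst G $$ (r, c)) (snd G $$ (r, c)))"

definition solves_within ::
    "nat \<Rightarrow> (real mat \<times> real mat) set \<Rightarrow>
     (real mat \<times> real mat \<Rightarrow> real vec \<times> real vec \<Rightarrow> bool) \<Rightarrow> nat \<Rightarrow> query_algorithm \<Rightarrow> bool" where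
  "solves_within k \<G> sol N A \<longleftrightarrow> (\<forall>G\<in>\<G>.
     set (queries G A) \<subseteq> {..<k} \<times> {..<k} \<and>
     length (queries G A) \<le> N \<and> sol G (returned_profile G A))"

(* Taking the infimum in enat makes the complexity infinite, rather than unspecified,
   if no algorithm with a uniform bound exists. *)
definition payoff_query_complexity ::
    "nat \<Rightarrow> (real mat \<times> real mat) set \<Rightarrow>
     (real mat \<times> real mat \<Rightarrow> real vec \<times> real vec \<Rightarrow> bool) \<Rightarrow> enat" where
  "payoff_query_complexity k \<G> sol = Inf {enat N | N. \<exists>A. solves_within k \<G> sol N A}"

end

theory Submission
  imports Defs
begin

text \<open>Query all of row 0 and let c be the best response of the column player to it. Then query
  column c in rows 1 to k - i + 1, so that only i - 2 entries of this column remain unknown, and let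
  s be the best row seen. The column player plays c; the row player gives weight 1/i to row 0, to
  row s and to each of the i - 2 unseen rows. Since c is a best response to a row of weight
  at least 1/i, the column player can gain only on the remaining weight 1 - 1/i. Some best response
  to c also has weight at least 1/i, so the row player secures a 1/i fraction of the best payoff.\<close>

lemma mult_mat_vec_unit_vec:
  fixes A :: "'a :: semiring_1 mat"
  assumes "A \<in> carrier_mat m n" "c < n"
  shows "A *\<^sub>v unit_vec n c = col A c"
  using assms by (intro eq_vecI) auto

lemma mixed_strategy_unit_vec: "c < k \<Longrightarrow> mixed_strategy k (unit_vec k c)"
  unfolding mixed_strategy_def by (auto simp: unit_vec_def)

text \<open>An empty sum cannot be 1. This makes the maxima in the regrets range over nonempty
  sets.\<close>

lemma mixed_strategy_nonempty: "mixed_strategy k x \<Longrightarrow> 0 < k"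
  by (rule ccontr) (simp add: mixed_strategy_def)

text \<open>Payoffs are nonnegative, so the weight on \<open>s\<close> alone secures
  \<open>p\<close> times the best payoff against \<open>c\<close>. The shortfall is at most
  \<open>1 - p\<close> times a payoff that is at most 1.\<close>

lemma row_regret_unit_vec_le:
  assumes R: "R \<in> carrier_mat k k" "\<And>r. r < k \<Longrightarrow> R $$ (r, c) \<in> {0..1}"
    and x: "mixed_strategy k x" and c: "c < k" and "p \<le> 1"
    and s: "s < k" "p \<le> x $ s" "\<And>r. r < k \<Longrightarrow> R $$ (r, c) \<le> R $$ (s, c)"
  shows "row_regret k R x (unit_vec k c) \<le> 1 - p"
proof -
  have payoff: "x \<bullet> (R *\<^sub>v unit_vec k c) = (\<Sum>r<k. x $ r * R $$ (r, c))"
    using R(1) c by (simp add: mult_mat_vec_unit_vec scalar_prod_def atLeast0LessThan)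
  have "p * R $$ (s, c) \<le> x $ s * R $$ (s, c)"
    using s R(2) by (intro mult_right_mono) auto
  also have "\<dots> \<le> (\<Sum>r<k. x $ r * R $$ (r, c))"
    using s x R(2) by (intro member_le_sum) (auto simp: mixed_strategy_def)
  finally have lower: "p * R $$ (s, c) \<le> x \<bullet> (R *\<^sub>v unit_vec k c)"
    by (simp only: payoff)
  have "(MAX r\<in>{..<k}. row R r \<bullet> unit_vec k c) \<le> R $$ (s, c)"
    using R(1) c s mixed_strategy_nonempty[OF x] by (subst Max_le_iff) auto
  moreover have "(1 - p) * R $$ (s, c) \<le> 1 - p"
    using R(2)[OF s(1)] \<open>p \<le> 1\<close> by (intro mult_left_le) auto
  ultimately show ?thesis
    using lower by (simp add: row_regret_def algebra_simps)
qed

text \<open>Deviating from \<open>c\<close> to \<open>j\<close> gains nothing against row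
  \<open>r\<close> and at most 1 against any other row; the other rows have total weight
  \<open>1 - x $ r\<close>.\<close>

lemma column_regret_unit_vec_le:
  assumes C: "C \<in> carrier_mat k k" "\<And>r j. r < k \<Longrightarrow> j < k \<Longrightarrow> C $$ (r, j) \<in> {0..1}"
    and x: "mixed_strategy k x" and c: "c < k"
    and r: "r < k" "p \<le> x $ r" "\<And>j. j < k \<Longrightarrow> C $$ (r, j) \<le> C $$ (r, c)"
  shows "column_regret k C x (unit_vec k c) \<le> 1 - p"
proof -
  have payoff: "x \<bullet> col C j = (\<Sum>l<k. x $ l * C $$ (l, j))" if "j < k" for j
    using C(1) that by (simp add: scalar_prod_def atLeast0LessThan)
  have nonneg: "0 \<le> x $ l" if "l < k" for l
    using x that by (simp add: mixed_strategy_def)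
  have "x \<bullet> col C j - x \<bullet> col C c \<le> 1 - p" if j: "j < k" for j
  proof -
    have "x \<bullet> col C j - x \<bullet> col C c = (\<Sum>l<k. x $ l * (C $$ (l, j) - C $$ (l, c)))"
      using j c by (simp add: payoff sum_subtractf right_diff_distrib)
    also have "\<dots> = x $ r * (C $$ (r, j) - C $$ (r, c))
        + (\<Sum>l\<in>{..<k} - {r}. x $ l * (C $$ (l, j) - C $$ (l, c)))"
      using r(1) by (subst sum.remove[of _ r]) auto
    also have "\<dots> \<le> 0 + (\<Sum>l\<in>{..<k} - {r}. x $ l)"
    proof (intro add_mono sum_mono)
      show "x $ r * (C $$ (r, j) - C $$ (r, c)) \<le> 0"
        using nonneg r j by (intro mult_nonneg_nonpos) auto
      show "x $ l * (C $$ (l, j) - C $$ (l, c)) \<le> x $ l" if "l \<in> {..<k} - {r}" for l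
        using nonneg[of l] C(2)[of l j] C(2)[of l c] that j c by (intro mult_left_le) auto
    qed
    also have "\<dots> = 1 - x $ r"
      using x r(1) by (simp add: mixed_strategy_def sum_diff1)
    finally show ?thesis
      using r(2) by simp
  qed
  then have "(MAX j\<in>{..<k}. x \<bullet> col C j) \<le> 1 - p + x \<bullet> col C c"
    using mixed_strategy_nonempty[OF x] by (subst Max_le_iff) (auto simp: algebra_simps)
  then show ?thesis
    using C(1) c by (simp add: column_regret_def mult_mat_vec_unit_vec)
qed

text \<open>A nonadaptive batch in continuation-passing style. Since \<open>f\<close> yields an
  algorithm, nesting two batches lets the second depend on the answers to the first.\<close>

primrec query_all ::
    "(nat \<times> nat) list \<Rightarrow> ((real \<times> real) list \<Rightarrow> query_algorithm) \<Rightarrow> query_algorithm" where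
  "query_all [] f = f []"
| "query_all (q # qs) f =
     Query (fst q) (snd q) (\<lambda>a b. query_all qs (\<lambda>answers. f ((a, b) # answers)))"

abbreviation payoffs :: "real mat \<times> real mat \<Rightarrow> nat \<times> nat \<Rightarrow> real \<times> real" where
  "payoffs G q \<equiv> (fst G $$ q, snd G $$ q)"

lemma returned_profile_query_all:
  "returned_profile G (query_all qs f) = returned_profile G (f (map (payoffs G) qs))"
  by (induction qs arbitrary: f) auto

lemma queries_query_all:
  "queries G (query_all qs f) = qs @ queries G (f (map (payoffs G) qs))"
  by (induction qs arbitrary: f) auto

text \<open>Ties are resolved by a fixed choice depending on the list alone, so the algorithm and
  its analysis refer to the same index.\<close>

definition argmax_nth :: "real list \<Rightarrow> nat" where
  "argmax_nth xs = arg_min_on (\<lambda>j. - xs ! j) {..<length xs}"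

lemma argmax_nth_less: "xs \<noteq> [] \<Longrightarrow> argmax_nth xs < length xs"
  using arg_min_if_finite(1)[of "{..<length xs}" "\<lambda>j. - xs ! j"]
  by (auto simp: argmax_nth_def lessThan_empty_iff)

lemma nth_le_argmax_nth: "j < length xs \<Longrightarrow> xs ! j \<le> xs ! argmax_nth xs"
  using arg_min_least[of "{..<length xs}" j "\<lambda>j. - xs ! j"]
  by (auto simp: argmax_nth_def)

text \<open>The indicators are added, not joined by a disjunction: if \<open>s = 0\<close>, row 0
  gets weight \<open>2 / i\<close> and the total is still 1.\<close>

definition row_mixture :: "nat \<Rightarrow> nat \<Rightarrow> nat \<Rightarrow> real vec" where
  "row_mixture k i s =
     vec k (\<lambda>j. (of_bool (j = 0) + of_bool (j = s) + of_bool (k - i + 2 \<le> j)) / real i)"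

lemma mixed_strategy_row_mixture:
  assumes "2 \<le> i" "i \<le> k" "s < k"
  shows "mixed_strategy k (row_mixture k i s)"
proof -
  \<comment> \<open>The third indicator holds for \<open>i - 2\<close> rows, so the three numerators
    sum to \<open>i\<close>.\<close>
  have "(\<Sum>j<k. of_bool (k - i + 2 \<le> j) :: real) = (\<Sum>j\<in>{k - i + 2..<k}. 1)"
    by (intro sum.mono_neutral_cong_right) auto
  then have "(\<Sum>j<k. row_mixture k i s $ j) = 1"
    using assms
    by (simp add: row_mixture_def sum.distrib flip: sum_divide_distrib)
  then show ?thesis
    by (simp add: mixed_strategy_def row_mixture_def)
qed

text \<open>The second list of answers starts with row 1, and row 0 of column c is known from the first.\<close>

definition find_approx_nash :: "nat \<Rightarrow> nat \<Rightarrow> query_algorithm" where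
  "find_approx_nash k i = query_all (map (Pair 0) [0..<k]) (\<lambda>as.
     let c = argmax_nth (map snd as) in
     query_all (map (\<lambda>r. (r, c)) [1..<k - i + 2]) (\<lambda>bs.
       Return (row_mixture k i (argmax_nth (map fst (as ! c # bs))), unit_vec k c)))"

lemma solves_within_find_approx_nash:
  assumes i: "2 \<le> i" "i \<le> k - 1"
  shows "solves_within k (bimatrix_games k) (approx_nash k (1 - 1 / real i))
           (2 * k - i + 1) (find_approx_nash k i)"
  unfolding solves_within_def
proof (intro ballI)
  fix G assume "G \<in> bimatrix_games k"
  then obtain R C where G: "G = (R, C)"
    and R: "R \<in> carrier_mat k k" "\<And>r c. r < k \<Longrightarrow> c < k \<Longrightarrow> R $$ (r, c) \<in> {0..1}"
    and C: "C \<in> carrier_mat k k" "\<And>r c. r < k \<Longrightarrow> c < k \<Longrightarrow> C $$ (r, c) \<in> {0..1}"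
    by (auto simp: bimatrix_games_def)
  define row0 where "row0 = map (\<lambda>j. C $$ (0, j)) [0..<k]"
  define c where "c = argmax_nth row0"
  define seen where "seen = map (\<lambda>r. R $$ (r, c)) [0..<k - i + 2]"
  define s where "s = argmax_nth seen"
  let ?x = "row_mixture k i s" and ?p = "1 / real i"
  have c: "c < k"
    using argmax_nth_less[of row0] i by (simp add: c_def row0_def)
  have c_best: "C $$ (0, j) \<le> C $$ (0, c)" if "j < k" for j
    using nth_le_argmax_nth[of j row0, folded c_def] that c by (simp add: row0_def)
  have s: "s < k - i + 2"
    using argmax_nth_less[of seen] by (simp add: s_def seen_def)
  have s_best: "R $$ (r, c) \<le> R $$ (s, c)" if "r < k - i + 2" for r
    using nth_le_argmax_nth[of r seen, folded s_def] that s
    by (simp add: seen_def del: upt_Suc)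
  have c_eq: "argmax_nth (map snd (map (payoffs G) (map (Pair 0) [0..<k]))) = c"
    by (simp add: G c_def row0_def comp_def)
  \<comment> \<open>Putting the known answer for row 0 in front of the second batch gives
    \<open>seen\<close>, so positions in the list are row numbers. \<open>upt_rec\<close> splits off
    this first entry.\<close>
  have s_eq: "argmax_nth (map fst (map (payoffs G) (map (Pair 0) [0..<k]) ! c #
      map (payoffs G) (map (\<lambda>r. (r, c)) [1..<k - i + 2]))) = s"
    using c by (simp add: G s_def seen_def comp_def upt_rec[of 0 "Suc (Suc (k - i))"] del: upt_Suc)
  have profile: "returned_profile G (find_approx_nash k i) = (?x, unit_vec k c)"
    unfolding find_approx_nash_def returned_profile_query_all Let_def c_eq
    by (simp only: returned_profile.simps s_eq)
  have queried: "queries G (find_approx_nash k i) =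
      map (Pair 0) [0..<k] @ map (\<lambda>r. (r, c)) [1..<k - i + 2]"
    unfolding find_approx_nash_def queries_query_all Let_def c_eq by simp
  have x: "mixed_strategy k ?x"
    using i s by (intro mixed_strategy_row_mixture) auto
  have weight: "?p \<le> ?x $ r" if "r < k" "r = 0 \<or> r = s \<or> k - i + 2 \<le> r" for r
    using that i by (auto simp: row_mixture_def divide_right_mono)
  \<comment> \<open>The algorithm need not know \<open>t\<close>: a best row \<open>b\<close> either
    is unseen, hence in the support, or was seen, and then \<open>s\<close> is at least as
    good.\<close>
  obtain t where t: "t < k" "\<And>r. r < k \<Longrightarrow> R $$ (r, c) \<le> R $$ (t, c)"
    "t = s \<or> k - i + 2 \<le> t"
  proof -
    define b where "b = argmax_nth (map (\<lambda>r. R $$ (r, c)) [0..<k])"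
    have b: "b < k" "\<And>r. r < k \<Longrightarrow> R $$ (r, c) \<le> R $$ (b, c)"
    proof -
      show "b < k"
        using argmax_nth_less[of "map (\<lambda>r. R $$ (r, c)) [0..<k]"] c by (simp add: b_def)
      then show "R $$ (r, c) \<le> R $$ (b, c)" if "r < k" for r
        using nth_le_argmax_nth[of r "map (\<lambda>r. R $$ (r, c)) [0..<k]", folded b_def] that
        by simp
    qed
    show ?thesis
    proof (cases "k - i + 2 \<le> b")
      case True
      then show ?thesis using b that by blast
    next
      case False
      then show ?thesis
        using b s i s_best[of b] by (intro that[of s]) (auto intro: order_trans)
    qed
  qed
  have "row_regret k R ?x (unit_vec k c) \<le> 1 - ?p"
    using i t c by (intro row_regret_unit_vec_le[OF R(1) R(2) x]) (auto intro: weight)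
  moreover have "column_regret k C ?x (unit_vec k c) \<le> 1 - ?p"
    \<comment> \<open>Row 0 is the row to which \<open>c\<close> was chosen as a best
      response.\<close>
    using c c_best by (intro column_regret_unit_vec_le[OF C x, where r = 0]) (auto intro: weight)
  ultimately show "set (queries G (find_approx_nash k i)) \<subseteq> {..<k} \<times> {..<k} \<and>
      length (queries G (find_approx_nash k i)) \<le> 2 * k - i + 1 \<and>
      approx_nash k (1 - 1 / real i) G (returned_profile G (find_approx_nash k i))"
    \<comment> \<open>The batches have \<open>k\<close> and \<open>k - i + 1\<close> queries. The
      second stays inside the matrix because \<open>k - i + 2\<close> is at most
      \<open>k\<close>.\<close>
    unfolding profile queried using c i x
    by (auto simp: approx_nash_def G mixed_strategy_unit_vec simp del: upt_Suc)
qed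

theorem theorem5:
  fixes k i :: nat
  assumes "2 \<le> i" and "i \<le> k - 1"
  shows "payoff_query_complexity k (bimatrix_games k) (approx_nash k (1 - 1 / real i))
           \<le> enat (2 * k - i + 1)"
  \<comment> \<open>The complexity is an infimum, so one algorithm suffices as a witness.\<close>
  unfolding payoff_query_complexity_def
  using solves_within_find_approx_nash[OF assms] by (intro Inf_lower) blast

end
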